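(* Let $D$ be a bounded convex open subset of $\mathbb{C}^n$, let $p \in D$ and let $\xi \in T_p^{(1,0)}D \setminus \{0\}$ (identified with $\mathbb{C}^n \setminus\{0\}$). Write $$D(\xi) := \{ z \in \mathbb{C} \mid p + (z/\|\xi\|)\xi \in D \},$$ $$r^{\bullet}(p,\xi) := \sup \{ r > 0 \mid \exists\, \zeta \in D(\xi) \text{ such that } 0 \in D(\zeta,r) \subseteq D(\xi) \},$$ $$S^{\bullet}(p,\xi) := \big\{ p + (z/\|\xi\|)\xi \mid z \in D(\xi),\ 0 \in \overline{D(z,r^{\bullet}(p,\xi))} \text{ and } D(z,r^{\bullet}(p,\xi)) \subseteq D(\xi) \big\}.$$ Let $r(p,\xi)$ denote the supremum of the radii of the discs centred at $p$, tangent to $\xi$, and included in $D$. Then: (1) $S^{\bullet}(p,\xi)$ is a non-empty compact convex subset of $\mathbb{C}^n$ (indeed, of $D \cap (p+\mathbb{C}\,\xi)$), and there exists a unique point $q(\xi) \in S^{\bullet}(p,\xi)$ such that $$\| q(\xi) - p \| = \mathrm{dist}(p,S^{\bullet}(p,\xi)).$$ Write $\beta := r^{\bullet}(p, \xi) - r(p, \xi)$ and $\gamma := \|q(\xi) - p\|^2 - \beta^2$. (2) If $(2 r(p,\xi) + \beta)\gamma \leq \beta\, r(p,\xi)^2$, then $$\kappa_D(p,\xi) \leq \frac{r^{\bullet}(p,\xi)}{r^{\bullet}(p,\xi)^2 - \|q(\xi)-p\|^2}\, \|\xi\|.$$ (3) If $(2 r(p,\xi) + \beta)\gamma > \beta\,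 r(p,\xi)^2$, then $$\kappa_D(p,\xi) \leq \frac{1}{2r(p,\xi)}\cdot \frac{\beta^2}{\|q(\xi)-p\|\,\big(\|q(\xi)-p\| - \sqrt{\gamma}\big)}\, \|\xi\|.$$ The upper bounds occurring in (2) and (3) are strictly smaller than $\|\xi\|/r(p,\xi)$ unless $q(\xi)=p$.
   Context: $\|\cdot\|$ is the Euclidean norm and $\mathrm{dist}(x,S)=\inf_{s\in S}\|x-s\|$. $D(a,r)$ denotes the open disc in $\mathbb{C}$ with centre $a$ and radius $r$ (to be distinguished from the set $D(\xi)$), and $\mathbb{D} = D(0,1)$. The disc of radius $s$ centred at $p$ and tangent to $\xi$ is $\{p + (z/\|\xi\|)\xi \mid z \in \mathbb{C},\ |z| < s\}$. $\kappa_D(p,\cdot)$ denotes the Kobayashi pseudo-metric of $D$ at $p$: $\kappa_D(p,\xi) = \inf\{ |v| : v \in \mathbb{C},\ \exists f:\mathbb{D}\to D \text{ holomorphic with } f(0)=p,\ f'(0)v = \xi\}$, normalized so that $\kappa_{\mathbb{D}}(z,1) = 1/(1-|z|^2)$. *)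

theory Defs
  imports "HOL-Complex_Analysis.Complex_Analysis"
begin

text \<open>
  Points and tangent vectors of $C^n$ are elements of \<open>complex ^ 'n\<close>: its \<open>norm\<close> is the
  Euclidean norm and \<open>*s\<close> is multiplication by complex scalars.
\<close>

definition tangent_point :: "complex ^ 'n \<Rightarrow> complex ^ 'n \<Rightarrow> complex \<Rightarrow> complex ^ 'n" where
  "tangent_point p \<xi> z = p + (z / complex_of_real (norm \<xi>)) *s \<xi>"

definition tangent_disc :: "complex ^ 'n \<Rightarrow> complex ^ 'n \<Rightarrow> real \<Rightarrow> (complex ^ 'n) set" where
  "tangent_disc p \<xi> s = {tangent_point p \<xi> z | z. norm z < s}"

definition slice :: "(complex ^ 'n) set \<Rightarrow> complex ^ 'n \<Rightarrow> complex ^ 'n \<Rightarrow> complex set" where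
  "slice D p \<xi> = {z. tangent_point p \<xi> z \<in> D}"

definition centred_radius :: "(complex ^ 'n) set \<Rightarrow> complex ^ 'n \<Rightarrow> complex ^ 'n \<Rightarrow> real" where
  "centred_radius D p \<xi> = Sup {s. s > 0 \<and> tangent_disc p \<xi> s \<subseteq> D}"

definition bullet_radius :: "(complex ^ 'n) set \<Rightarrow> complex ^ 'n \<Rightarrow> complex ^ 'n \<Rightarrow> real" where
  "bullet_radius D p \<xi> =
     Sup {r. r > 0 \<and> (\<exists>\<zeta>\<in>slice D p \<xi>. 0 \<in> ball \<zeta> r \<and> ball \<zeta> r \<subseteq> slice D p \<xi>)}"

definition bullet_set :: "(complex ^ 'n) set \<Rightarrow> complex ^ 'n \<Rightarrow> complex ^ 'n \<Rightarrow> (complex ^ 'n) set" where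
  "bullet_set D p \<xi> =
     {tangent_point p \<xi> z | z. z \<in> slice D p \<xi> \<and>
        0 \<in> closure (ball z (bullet_radius D p \<xi>)) \<and>
        ball z (bullet_radius D p \<xi>) \<subseteq> slice D p \<xi>}"

text \<open>
  Holomorphy and the derivative of a map into $C^n$ are taken componentwise.  With the
  infimum below the metric of the unit disc is $1/(1-|z|^2)$, without a factor 2.
\<close>

definition kobayashi_metric :: "(complex ^ 'n) set \<Rightarrow> complex ^ 'n \<Rightarrow> complex ^ 'n \<Rightarrow> real" where
  "kobayashi_metric D p \<xi> =
     Inf {norm v | v :: complex. \<exists>f :: complex \<Rightarrow> complex ^ 'n.
        (\<forall>i. (\<lambda>z. f z $ i) holomorphic_on ball 0 1) \<and> f ` ball 0 1 \<subseteq> D \<and> f 0 = p \<and>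
        v *s (\<chi> i. deriv (\<lambda>z. f z $ i) 0) = \<xi>}"

end

theory Submission
  imports Defs
begin

text \<open>
  The theorem lives in the complex line through \<open>p\<close> in direction \<open>\<xi>\<close>. The map
  \<open>tangent_point p \<xi>\<close> is an affine isometry of the plane onto this line, so \<open>D\<close> leaves
  there the trace \<open>\<Omega> = slice D p \<xi>\<close>, a bounded convex open set containing \<open>0\<close>, and
  \<open>bullet_set D p \<xi>\<close> is the isometric image of the set of centres \<open>z\<close> with
  \<open>\<bar>z\<bar> \<le> R\<close> and \<open>ball z R \<subseteq> \<Omega>\<close>, where \<open>R = bullet_radius D p \<xi>\<close>.

  This set of centres is not empty, since a sequence of admissible discs with radii
  tending to \<open>R\<close> subconverges to a disc of radius \<open>R\<close> in \<open>\<Omega>\<close> whose closure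
  contains \<open>0\<close> (\<open>ball_through_radius_Sup\<close>). It is closed because \<open>ball z R \<subseteq> \<Omega>\<close> says
  that \<open>z\<close> has distance at least \<open>R\<close> from every point outside \<open>\<Omega>\<close>, and convex because
  convex combinations of discs in \<open>\<Omega>\<close> stay in \<open>\<Omega>\<close> (\<open>ball_convex_combination_subset\<close>).
  A nonempty closed convex set has exactly one point nearest to \<open>p\<close>.

  For the estimates, every disc \<open>ball c \<rho> \<subseteq> \<Omega>\<close> that contains \<open>0\<close> yields
  \<open>\<rho> / (\<rho>\<^sup>2 - \<bar>c\<bar>\<^sup>2) * norm \<xi>\<close> as an upper bound of the metric, namely the Poincare metric
  of that disc at \<open>0\<close> (\<open>kobayashi_metric_le_disc\<close>). Write \<open>r\<close> for the centred radius,
  \<open>\<beta> = R - r\<close>, and \<open>d\<close> for the norm of the centre \<open>z\<close> corresponding to \<open>q\<close>. By convexity,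
  \<open>\<Omega>\<close> contains with \<open>ball 0 r\<close> and \<open>ball z R\<close> also all discs with centre \<open>t z\<close> and radius
  \<open>\<rho> = r + t \<beta>\<close>, where \<open>0 \<le> t \<le> 1\<close>. The quantity to be maximised is thus
  \<open>\<rho> - t\<^sup>2 d\<^sup>2 / \<rho> = \<rho> - (d\<^sup>2 / \<beta>\<^sup>2) (\<rho> - 2 r + r\<^sup>2 / \<rho>)\<close>,
  a concave function of \<open>\<rho>\<close> when \<open>\<beta>, d > 0\<close>. If \<open>\<gamma> = d\<^sup>2 - \<beta>\<^sup>2 > 0\<close>, its critical point is
  \<open>\<rho> = r d / sqrt \<gamma>\<close>, and this satisfies \<open>\<rho> \<le> R\<close> exactly when
  \<open>\<beta> r\<^sup>2 \<le> (2 r + \<beta>) \<gamma>\<close>. Beyond this threshold the critical disc gives the bound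
  \<open>bound3\<close> (\<open>hull_disc_bound\<close>); below it the largest disc \<open>ball z R\<close> is used, giving
  \<open>bound2\<close> (\<open>disc_bound_less\<close>). Both improve strictly on the disc \<open>ball 0 r\<close>, the choice
  \<open>t = 0\<close>, unless \<open>\<beta> = 0\<close>, and \<open>\<beta> = 0\<close> forces \<open>q = p\<close>.
\<close>

section \<open>Balls contained in a convex set\<close>

text \<open>
  The Minkowski combination of the two balls is the ball with the combined centre and radius:
  a vector \<open>v\<close> shorter than the combined radius \<open>\<rho>\<close> is split in the proportion of the radii, as
  \<open>(r / \<rho>) v\<close> in the first ball and \<open>(s / \<rho>) v\<close> in the second.
\<close>
lemma ball_convex_combination_subset:
  fixes x y :: "'a::real_normed_vector"
  assumes "convex \<Omega>" and "ball x r \<subseteq> \<Omega>" and "ball y s \<subseteq> \<Omega>"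
    and "0 < r" and "0 < s" and "0 \<le> t" and "t \<le> 1"
  shows "ball ((1 - t) *\<^sub>R x + t *\<^sub>R y) ((1 - t) * r + t * s) \<subseteq> \<Omega>"
proof
  fix w assume w: "w \<in> ball ((1 - t) *\<^sub>R x + t *\<^sub>R y) ((1 - t) * r + t * s)"
  define \<rho> v where "\<rho> = (1 - t) * r + t * s"
    and "v = w - ((1 - t) *\<^sub>R x + t *\<^sub>R y)"
  have \<rho>: "\<rho> > 0"
    unfolding \<rho>_def using assms(4-7)
    by (cases "t = 0") (auto intro: add_nonneg_pos)
  have v: "norm v < \<rho>"
    using w by (simp add: \<rho>_def v_def dist_norm norm_minus_commute)
  have scaled: "a + (e / \<rho>) *\<^sub>R v \<in> ball a e" if "e > 0" for a e
    using that v \<rho> by (simp add: dist_norm field_simps)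
  have "(1 - t) *\<^sub>R (x + (r / \<rho>) *\<^sub>R v) + t *\<^sub>R (y + (s / \<rho>) *\<^sub>R v) \<in> \<Omega>"
    using assms scaled by (intro convexD) auto
  also have "(1 - t) *\<^sub>R (x + (r / \<rho>) *\<^sub>R v) + t *\<^sub>R (y + (s / \<rho>) *\<^sub>R v) =
      (1 - t) *\<^sub>R x + t *\<^sub>R y + (((1 - t) * r + t * s) / \<rho>) *\<^sub>R v"
    by (simp add: algebra_simps add_divide_distrib diff_divide_distrib)
  also have "\<dots> = w"
    using \<rho> by (simp flip: \<rho>_def) (simp add: v_def)
  finally show "w \<in> \<Omega>" .
qed

text \<open>
  The inclusion is a family of closed conditions on the centre, one for each point outside
  \<open>\<Omega>\<close>.
\<close>
lemma closed_ball_subset_centres: "closed {z :: 'a::metric_space. ball z e \<subseteq> \<Omega>}"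
proof -
  have "{z. ball z e \<subseteq> \<Omega>} = (\<Inter>w\<in>- \<Omega>. {z. e \<le> dist z w})"
    by (force simp: subset_iff not_less)
  then show ?thesis
    by (auto intro!: closed_INT closed_Collect_le continuous_intros)
qed

lemma convex_ball_subset_centres:
  fixes \<Omega> :: "'a::real_normed_vector set"
  assumes "convex \<Omega>" and "e > 0"
  shows "convex {z. ball z e \<subseteq> \<Omega>}"
  unfolding convex_alt
proof (intro ballI allI impI CollectI)
  fix x y :: 'a and t :: real
  assume *: "x \<in> {z. ball z e \<subseteq> \<Omega>}" "y \<in> {z. ball z e \<subseteq> \<Omega>}" "0 \<le> t \<and> t \<le> 1"
  have "ball ((1 - t) *\<^sub>R x + t *\<^sub>R y) ((1 - t) * e + t * e) \<subseteq> \<Omega>"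
    using * assms by (intro ball_convex_combination_subset) auto
  then show "ball ((1 - t) *\<^sub>R x + t *\<^sub>R y) e \<subseteq> \<Omega>"
    by (simp add: algebra_simps)
qed

lemma bounded_imp_ball_radius_bounded:
  fixes \<Omega> :: "'a::euclidean_space set"
  assumes "bounded \<Omega>"
  obtains B where "\<And>z e. ball z e \<subseteq> \<Omega> \<Longrightarrow> e \<le> B"
proof -
  obtain B where B: "B > 0" "\<Omega> \<subseteq> ball 0 B"
    using bounded_subset_ballD[OF assms] by blast
  have "e \<le> B" if "ball z e \<subseteq> \<Omega>" for z e
  proof -
    have "ball z e \<subseteq> ball 0 B"
      using that B(2) by blast
    then have "dist z 0 + e \<le> B \<or> e \<le> 0"
      by (simp only: ball_subset_ball_iff)
    with B(1) zero_le_dist[of z 0] show ?thesis by linarith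
  qed
  then show ?thesis using that by blast
qed

text \<open>
  The supremum of the radii of balls around \<open>x\<close> is attained because the balls are open and
  nested.
\<close>
lemma centred_ball_radius_Sup:
  fixes \<Omega> :: "'a::euclidean_space set"
  assumes "bounded \<Omega>" and "open \<Omega>" and "x \<in> \<Omega>"
  defines "r \<equiv> Sup {s. s > 0 \<and> ball x s \<subseteq> \<Omega>}"
  shows "r > 0" and "ball x r \<subseteq> \<Omega>" and "\<And>s. ball x s \<subseteq> \<Omega> \<Longrightarrow> s \<le> r"
proof -
  obtain s0 where s0: "s0 > 0" "ball x s0 \<subseteq> \<Omega>"
    using assms(2,3) openE by blast
  have bdd: "bdd_above {s. s > 0 \<and> ball x s \<subseteq> \<Omega>}"
    using bounded_imp_ball_radius_bounded[OF assms(1)] by (metis (mono_tags, lifting) bdd_aboveI mem_Collect_eq)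
  have upper: "s \<le> r" if "s > 0" "ball x s \<subseteq> \<Omega>" for s
    unfolding r_def using that by (intro cSup_upper[OF _ bdd]) auto
  show "r > 0"
    using upper[OF s0] s0 by linarith
  then show "s \<le> r" if "ball x s \<subseteq> \<Omega>" for s
    using upper[of s] that by linarith
  show "ball x r \<subseteq> \<Omega>"
  proof
    fix w assume "w \<in> ball x r"
    then have "dist x w < Sup {s. s > 0 \<and> ball x s \<subseteq> \<Omega>}"
      by (simp add: r_def)
    then obtain s where "ball x s \<subseteq> \<Omega>" "dist x w < s"
      using s0 by (subst (asm) less_cSup_iff[OF _ bdd]) auto
    then show "w \<in> \<Omega>" by auto
  qed
qed

text \<open>
  If the centre may vary, the balls are no longer nested and compactness has to replace
  monotonicity. In the limit only \<open>x \<in> cball z R\<close> survives, and \<open>x\<close> may indeed lie on the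
  boundary of the extremal ball: this happens in a planar wedge, with \<open>x\<close> near its tip.
  Centre and radius are treated as one point of the product space: the set \<open>G\<close> of admissible
  pairs is bounded, so that \<open>R\<close> is the radius of a pair in its closure, and the closed set
  \<open>F\<close> retains what is left of admissibility in the limit.
\<close>
lemma ball_through_radius_Sup:
  fixes \<Omega> :: "'a::euclidean_space set"
  assumes "bounded \<Omega>" and "open \<Omega>" and "x \<in> \<Omega>"
  defines "R \<equiv> Sup {r. r > 0 \<and> (\<exists>z\<in>\<Omega>. x \<in> ball z r \<and> ball z r \<subseteq> \<Omega>)}"
  shows "\<And>s z. x \<in> ball z s \<Longrightarrow> ball z s \<subseteq> \<Omega> \<Longrightarrow> s \<le> R"
    and "\<exists>z\<in>cball x R. ball z R \<subseteq> \<Omega>"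
proof -
  define G where "G = {(z, s). s > 0 \<and> z \<in> \<Omega> \<and> x \<in> ball z s \<and> ball z s \<subseteq> \<Omega>}"
  define F where "F = {(z, s). dist z x \<le> s} \<inter> (\<Inter>w\<in>- \<Omega>. {(z, s). s \<le> dist z w})"
  have R: "R = Sup (snd ` G)"
    unfolding R_def G_def by (intro arg_cong[of _ _ Sup]) force
  obtain B where B: "\<And>z e. ball z e \<subseteq> \<Omega> \<Longrightarrow> e \<le> B"
    using bounded_imp_ball_radius_bounded[OF assms(1)] by blast
  have bddR: "bounded (snd ` G)"
    unfolding bounded_iff using B by (intro exI[of _ B]) (auto simp: G_def)
  have "bounded (fst ` G)"
    using assms(1) by (rule bounded_subset) (auto simp: G_def)
  with bddR have bddG: "bounded G"
    by (rule_tac bounded_subset[OF bounded_Times subset_fst_snd])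
  have cpt: "compact (snd ` closure G)"
    using bddG by (intro compact_continuous_image continuous_intros) (simp add: compact_closure)
  have bdd: "bdd_above (snd ` G)"
    using bddR by (rule bounded_imp_bdd_above)
  show upper: "s \<le> R" if "x \<in> ball z s" "ball z s \<subseteq> \<Omega>" for s z
  proof -
    have "s > 0" using that(1) zero_le_dist[of z x] unfolding mem_ball by linarith
    moreover from this that have "z \<in> \<Omega>" by auto
    ultimately have "(z, s) \<in> G" using that by (simp add: G_def)
    then show ?thesis
      unfolding R by (intro cSup_upper[OF _ bdd]) force
  qed
  obtain s0 where "s0 > 0" "ball x s0 \<subseteq> \<Omega>"
    using assms(2,3) openE by blast
  then have "(x, s0) \<in> G" using assms(3) by (simp add: G_def)
  then have "snd ` G \<noteq> {}" by blast
  then have "R \<in> closure (snd ` G)"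
    unfolding R using bdd by (rule closure_contains_Sup)
  also have "\<dots> \<subseteq> snd ` closure G"
    using cpt by (intro closure_minimal image_mono closure_subset compact_imp_closed)
  finally obtain z where z: "(z, R) \<in> closure G" by force
  have "closed F"
    unfolding F_def case_prod_unfold
    by (intro closed_Int closed_INT ballI closed_Collect_le continuous_intros)
  moreover have "G \<subseteq> F"
    unfolding G_def F_def
    by (auto simp: dist_commute subset_iff) (meson linorder_not_less)
  ultimately have "closure G \<subseteq> F" by (simp add: closure_minimal)
  with z have "(z, R) \<in> F" by blast
  then have "dist z x \<le> R" and "\<And>w. w \<notin> \<Omega> \<Longrightarrow> R \<le> dist z w"
    by (auto simp: F_def)
  then have "z \<in> cball x R" and "ball z R \<subseteq> \<Omega>"
    by (auto simp: dist_commute) (meson linorder_not_less)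
  then show "\<exists>z\<in>cball x R. ball z R \<subseteq> \<Omega>" by blast
qed

text \<open>
  Existence is Weierstrass, uniqueness is the strict convexity of the Euclidean norm.
\<close>
lemma unique_nearest_point:
  fixes a :: "'a::euclidean_space"
  assumes "convex S" and "closed S" and "S \<noteq> {}"
  shows "\<exists>!q. q \<in> S \<and> norm (q - a) = infdist a S"
proof (rule ex_ex1I)
  have "dist a (closest_point S a) = infdist a S"
    using assms(2,3) by (simp add: infdist_eq_setdist setdist_closest_point)
  then show "\<exists>q. q \<in> S \<and> norm (q - a) = infdist a S"
    using closest_point_in_set[OF assms(2,3)] by (metis dist_norm norm_minus_commute)
next
  fix x y
  assume "x \<in> S \<and> norm (x - a) = infdist a S" and "y \<in> S \<and> norm (y - a) = infdist a S"
  then have "x \<in> S" "y \<in> S" "dist a x = infdist a S" "dist a y = infdist a S"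
    by (simp_all add: dist_norm norm_minus_commute)
  then show "x = y"
    using any_closest_point_unique[OF assms(1,2), of x y a] by (simp add: infdist_le)
qed

section \<open>The trace of a domain on a complex line\<close>

lemma tangent_point_diff:
  "tangent_point p \<xi> z - tangent_point p \<xi> w = ((z - w) / complex_of_real (norm \<xi>)) *s \<xi>"
  by (simp add: vec_eq_iff tangent_point_def left_diff_distrib diff_divide_distrib)

lemma norm_vector_smult: "norm (c *s (x :: complex ^ 'n)) = norm c * norm x"
  by (simp add: norm_vec_def norm_mult L2_set_right_distrib)

lemma dist_tangent_point:
  assumes "\<xi> \<noteq> 0"
  shows "dist (tangent_point p \<xi> z) (tangent_point p \<xi> w) = dist z w"
  using assms by (simp add: dist_norm tangent_point_diff norm_vector_smult norm_divide)

lemma tangent_point_0 [simp]: "tangent_point p \<xi> 0 = p"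
  by (simp add: tangent_point_def)

lemma tangent_point_convex_combination:
  "tangent_point p \<xi> ((1 - t) *\<^sub>R x + t *\<^sub>R y) =
     (1 - t) *\<^sub>R tangent_point p \<xi> x + t *\<^sub>R tangent_point p \<xi> y"
  unfolding vec_eq_iff tangent_point_def vector_add_component vector_scaleR_component
    vector_smult_component scaleR_conv_of_real[where 'a = complex]
  by (auto simp: divide_inverse algebra_simps)

lemma continuous_on_tangent_point:
  "\<xi> \<noteq> 0 \<Longrightarrow> continuous_on A (tangent_point p \<xi>)"
  unfolding continuous_on_iff by (simp add: dist_tangent_point) blast

lemma slice_eq_vimage: "slice D p \<xi> = tangent_point p \<xi> -` D"
  by (auto simp: slice_def)

lemma bounded_slice:
  assumes "bounded D" and "\<xi> \<noteq> 0"
  shows "bounded (slice D p \<xi>)"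
proof -
  obtain e where e: "\<And>y. y \<in> D \<Longrightarrow> dist p y \<le> e"
    using assms(1) bounded_any_center[of D p] by blast
  have "dist 0 z \<le> e" if "z \<in> slice D p \<xi>" for z
    using e[of "tangent_point p \<xi> z"] that dist_tangent_point[OF assms(2), of p 0 z]
    by (simp add: slice_def)
  then show ?thesis unfolding bounded_def by blast
qed

lemma convex_slice:
  assumes "convex D"
  shows "convex (slice D p \<xi>)"
  using assms unfolding convex_alt slice_def mem_Collect_eq tangent_point_convex_combination by blast

lemma open_slice:
  assumes "open D" and "\<xi> \<noteq> 0"
  shows "open (slice D p \<xi>)"
  unfolding slice_eq_vimage using assms by (intro open_vimage continuous_on_tangent_point)

lemma centred_radius_slice:
  "centred_radius D p \<xi> = Sup {s. s > 0 \<and> ball 0 s \<subseteq> slice D p \<xi>}"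
  unfolding centred_radius_def tangent_disc_def slice_def
  by (intro arg_cong[of _ _ Sup] Collect_cong) (auto simp: subset_iff)

text \<open>
  Compactness and convexity can be read off from this form: an affine isometric image of the
  intersection of a compact convex and a closed convex set.
\<close>
lemma bullet_set_image:
  assumes "bullet_radius D p \<xi> > 0"
  shows "bullet_set D p \<xi> = tangent_point p \<xi> `
    (cball 0 (bullet_radius D p \<xi>) \<inter> {z. ball z (bullet_radius D p \<xi>) \<subseteq> slice D p \<xi>})"
proof -
  have "z \<in> slice D p \<xi>" if "ball z (bullet_radius D p \<xi>) \<subseteq> slice D p \<xi>" for z
    using that assms by auto
  with assms show ?thesis
    unfolding bullet_set_def by (auto simp: closure_ball)
qed

section \<open>Discs in the slice bound the metric\<close>

text \<open>
  This reduces the estimates to dimension one: composed with the embedding of the slice, \<open>\<phi>\<close>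
  becomes a competitor in the infimum that defines the metric.
\<close>
lemma kobayashi_metric_le_slice_map:
  assumes "\<xi> \<noteq> 0" and "\<phi> holomorphic_on ball 0 1" and "\<phi> ` ball 0 1 \<subseteq> slice D p \<xi>"
    and "\<phi> 0 = 0" and "(\<phi> has_field_derivative a) (at 0)" and "a \<noteq> 0"
  shows "kobayashi_metric D p \<xi> \<le> norm \<xi> / norm a"
proof -
  define f where "f = (\<lambda>z. tangent_point p \<xi> (\<phi> z))"
  define v where "v = complex_of_real (norm \<xi>) / a"
  have comp: "(\<lambda>z. f z $ i) = (\<lambda>z. p $ i + \<phi> z / complex_of_real (norm \<xi>) * \<xi> $ i)" for i
    by (simp add: f_def tangent_point_def)
  have "(\<lambda>z. f z $ i) holomorphic_on ball 0 1" for i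
    unfolding comp using assms(1,2) by (intro holomorphic_intros) auto
  moreover have "f ` ball 0 1 \<subseteq> D"
    using assms(3) by (auto simp: f_def slice_def)
  moreover have "f 0 = p"
    by (simp add: f_def assms(4))
  moreover have "deriv (\<lambda>z. f z $ i) 0 = a / complex_of_real (norm \<xi>) * \<xi> $ i" for i
    unfolding comp using assms(1)
    by (intro DERIV_imp_deriv) (auto intro!: derivative_eq_intros assms(5))
  then have "v *s (\<chi> i. deriv (\<lambda>z. f z $ i) 0) = \<xi>"
    using assms(1,6) by (simp add: vec_eq_iff v_def)
  ultimately have "kobayashi_metric D p \<xi> \<le> norm v"
    unfolding kobayashi_metric_def
    by (intro cInf_lower bdd_belowI[of _ 0] CollectI exI[of _ v] exI[of _ f] conjI allI refl) auto
  then show ?thesis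
    by (simp add: v_def norm_divide)
qed

text \<open>
  The competitor is an automorphism of the unit disc, composed with the affine map onto
  \<open>ball c \<rho>\<close> and chosen such that \<open>0\<close> is fixed; its derivative at \<open>0\<close> is
  \<open>(\<rho>\<^sup>2 - \<bar>c\<bar>\<^sup>2) / \<rho>\<close>.
\<close>
lemma kobayashi_metric_le_disc:
  assumes "\<xi> \<noteq> 0" and "ball c \<rho> \<subseteq> slice D p \<xi>" and "norm c < \<rho>"
  shows "kobayashi_metric D p \<xi> \<le> \<rho> / (\<rho>\<^sup>2 - (norm c)\<^sup>2) * norm \<xi>"
proof -
  have \<rho>: "\<rho> > 0" using assms(3) norm_ge_zero[of c] by linarith
  define a where "a = c / complex_of_real \<rho>"
  have a: "norm a < 1" using assms(3) \<rho> by (simp add: a_def norm_divide)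
  define \<phi> where "\<phi> = (\<lambda>z. c + complex_of_real \<rho> * Moebius_function 0 a z)"
  have hol: "\<phi> holomorphic_on ball 0 1"
    unfolding \<phi>_def using a by (intro holomorphic_intros Moebius_function_holomorphic)
  have "\<phi> z \<in> ball c \<rho>" if "z \<in> ball 0 1" for z
    using Moebius_function_norm_lt_1[OF a, of z 0] that \<rho>
    by (simp add: \<phi>_def dist_norm norm_mult)
  with assms(2) have img: "\<phi> ` ball 0 1 \<subseteq> slice D p \<xi>" by blast
  have zero: "\<phi> 0 = 0"
    using \<rho> by (simp add: \<phi>_def Moebius_function_def a_def)
  have "(\<phi> has_field_derivative complex_of_real \<rho> * (1 - a * cnj a)) (at 0)"
    unfolding \<phi>_def Moebius_function_def
    by (auto intro!: derivative_eq_intros simp: algebra_simps)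
  also have "complex_of_real \<rho> * (1 - a * cnj a) = complex_of_real ((\<rho>\<^sup>2 - (norm c)\<^sup>2) / \<rho>)"
  proof -
    have "\<rho> * (1 - (norm a)\<^sup>2) = (\<rho>\<^sup>2 - (norm c)\<^sup>2) / \<rho>"
      using \<rho> by (simp add: a_def norm_divide field_simps power2_eq_square)
    moreover have "complex_of_real \<rho> * (1 - a * cnj a) = complex_of_real (\<rho> * (1 - (norm a)\<^sup>2))"
      unfolding complex_norm_square[symmetric] by simp
    ultimately show ?thesis by (simp only:)
  qed
  finally have der: "(\<phi> has_field_derivative complex_of_real ((\<rho>\<^sup>2 - (norm c)\<^sup>2) / \<rho>)) (at 0)" .
  have "(norm c)\<^sup>2 < \<rho>\<^sup>2"
    using assms(3) by (intro power_strict_mono) auto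
  then have pos: "0 < (\<rho>\<^sup>2 - (norm c)\<^sup>2) / \<rho>"
    using \<rho> by (intro divide_pos_pos) simp_all
  then have nz: "complex_of_real ((\<rho>\<^sup>2 - (norm c)\<^sup>2) / \<rho>) \<noteq> 0"
    unfolding of_real_eq_0_iff by (rule less_imp_neq[THEN not_sym])
  have "norm (complex_of_real ((\<rho>\<^sup>2 - (norm c)\<^sup>2) / \<rho>)) = (\<rho>\<^sup>2 - (norm c)\<^sup>2) / \<rho>"
    unfolding norm_of_real using pos by (rule abs_of_pos)
  then show ?thesis
    using kobayashi_metric_le_slice_map[OF assms(1) hol img zero der nz]
    by (simp add: mult.commute)
qed

section \<open>The choice of the disc\<close>

text \<open>
  Where \<open>d < r + \<beta>\<close>, the bound from the disc of radius \<open>r + \<beta>\<close> is below \<open>1 / r\<close> exactly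
  if \<open>d\<^sup>2 - \<beta>\<^sup>2 < \<beta> r\<close>. This inequality also implies \<open>d < r + \<beta>\<close>, and the
  hypothesis gives at most \<open>\<beta> r\<^sup>2 / (2 r + \<beta>)\<close> on the left.
\<close>
lemma disc_bound_less:
  fixes r \<beta> d :: real
  assumes "0 < r" and "0 < \<beta>" and "(2 * r + \<beta>) * (d\<^sup>2 - \<beta>\<^sup>2) \<le> \<beta> * r\<^sup>2"
  shows "d\<^sup>2 < (r + \<beta>)\<^sup>2" and "(r + \<beta>) / ((r + \<beta>)\<^sup>2 - d\<^sup>2) < 1 / r"
proof -
  have "(2 * r + \<beta>) * (d\<^sup>2 - \<beta>\<^sup>2) < (2 * r + \<beta>) * (\<beta> * r)"
    using assms by (intro order.strict_trans1[OF assms(3)]) (simp add: power2_eq_square algebra_simps add_pos_pos)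
  then have *: "d\<^sup>2 - \<beta>\<^sup>2 < \<beta> * r"
    using assms by (simp add: mult_less_cancel_left_pos)
  have "0 < r\<^sup>2" "0 < \<beta> * r" using assms by auto
  with * show "d\<^sup>2 < (r + \<beta>)\<^sup>2"
    unfolding power2_sum by (simp only: mult_ac)
  then show "(r + \<beta>) / ((r + \<beta>)\<^sup>2 - d\<^sup>2) < 1 / r"
    using * assms(1) by (simp add: field_simps power2_eq_square)
qed

text \<open>
  Here \<open>\<rho>\<close> is the critical point of \<open>\<rho> - t\<^sup>2 d\<^sup>2 / \<rho>\<close> under the constraint \<open>\<rho> = r + t \<beta>\<close>,
  and the inequality between \<open>\<beta> * r\<^sup>2\<close> and \<open>(2 * r + \<beta>) * (d\<^sup>2 - \<beta>\<^sup>2)\<close> says that this point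
  is reached before \<open>t = 1\<close>. All identities come from \<open>\<beta>\<^sup>2 = (d - g) (d + g)\<close>, which turns
  \<open>b\<close> into \<open>(d + g) / (2 r d)\<close>; from this \<open>b < 1 / r\<close> is the inequality \<open>g < d\<close>.
\<close>
lemma hull_disc_bound:
  fixes r \<beta> d :: real
  assumes "0 < r" and "0 < \<beta>" and "0 < d" and "\<beta> * r\<^sup>2 < (2 * r + \<beta>) * (d\<^sup>2 - \<beta>\<^sup>2)"
  defines "g \<equiv> sqrt (d\<^sup>2 - \<beta>\<^sup>2)"
  defines "\<rho> \<equiv> r * d / g"
  defines "t \<equiv> (\<rho> - r) / \<beta>"
  defines "b \<equiv> 1 / (2 * r) * (\<beta>\<^sup>2 / (d * (d - g)))"
  shows "0 \<le> t" and "t \<le> 1" and "t * d < \<rho>" and "\<rho> / (\<rho>\<^sup>2 - (t * d)\<^sup>2) = b" and "b < 1 / r"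
proof -
  have g2pos: "d\<^sup>2 - \<beta>\<^sup>2 > 0"
  proof -
    have "0 < (2 * r + \<beta>) * (d\<^sup>2 - \<beta>\<^sup>2)"
      using assms(4) by (rule order.strict_trans[rotated]) (use assms(1,2) in simp)
    then show ?thesis using assms(1,2) by (simp add: zero_less_mult_iff)
  qed
  have g: "g > 0" and g2: "g\<^sup>2 = d\<^sup>2 - \<beta>\<^sup>2"
    using g2pos by (auto simp: g_def)
  have "g\<^sup>2 < d\<^sup>2" using assms(2) by (simp add: g2)
  then have gd: "g < d" by (rule power2_less_imp_less) (use assms(3) in simp)
  show t0: "0 \<le> t"
    using assms(1,2) g gd by (simp add: t_def \<rho>_def field_simps)
  \<comment> \<open>Squared, \<open>\<rho> \<le> r + \<beta>\<close> is \<open>\<beta>\<close> times the hypothesis.\<close>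
  have "(r * d)\<^sup>2 \<le> ((r + \<beta>) * g)\<^sup>2"
  proof -
    have "((r + \<beta>) * g)\<^sup>2 - (r * d)\<^sup>2 = \<beta> * ((2 * r + \<beta>) * (d\<^sup>2 - \<beta>\<^sup>2) - \<beta> * r\<^sup>2)"
      unfolding power_mult_distrib g2 by (simp add: algebra_simps power2_eq_square)
    also have "\<dots> \<ge> 0" using assms(2,4) by simp
    finally show ?thesis by simp
  qed
  then have "r * d \<le> (r + \<beta>) * g"
    by (rule power2_le_imp_le) (use assms(1,2) g in simp)
  then show "t \<le> 1"
    using assms(2) g by (simp add: t_def \<rho>_def field_simps)
  have \<beta>2: "\<beta>\<^sup>2 = (d - g) * (d + g)" using g2 by (simp add: algebra_simps power2_eq_square)
  have \<rho>: "\<rho> > 0" using assms(1,3) g by (simp add: \<rho>_def)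
  have "(t * d)\<^sup>2 * \<beta>\<^sup>2 = (r * d / g)\<^sup>2 * (d - g)\<^sup>2"
    using assms(2) g by (simp add: t_def \<rho>_def field_simps power2_eq_square)
  then have td: "(t * d)\<^sup>2 = \<rho>\<^sup>2 * ((d - g) / (d + g))"
  proof -
    assume "(t * d)\<^sup>2 * \<beta>\<^sup>2 = (r * d / g)\<^sup>2 * (d - g)\<^sup>2"
    then have "(d - g) * ((t * d)\<^sup>2 * (d + g)) = (d - g) * (\<rho>\<^sup>2 * (d - g))"
      unfolding \<beta>2 \<rho>_def by (simp add: power2_eq_square mult_ac)
    then have "(t * d)\<^sup>2 * (d + g) = \<rho>\<^sup>2 * (d - g)"
      using gd by (simp only: mult_cancel_left) auto
    then show ?thesis using g assms(3) by (simp add: field_simps)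
  qed
  have diff: "\<rho>\<^sup>2 - (t * d)\<^sup>2 = \<rho>\<^sup>2 * (2 * g / (d + g))"
    unfolding td using g assms(3) by (simp add: field_simps)
  also have "\<dots> > 0" using \<rho> g assms(3) by simp
  finally have "(t * d)\<^sup>2 < \<rho>\<^sup>2" by simp
  then show "t * d < \<rho>"
    by (rule power2_less_imp_less) (use \<rho> in simp)
  have "b = (d + g) / (2 * r * d)"
    unfolding b_def \<beta>2 using gd assms(1,3) by (simp add: field_simps)
  also have "\<dots> = \<rho> / (\<rho>\<^sup>2 * (2 * g / (d + g)))"
    using \<rho> g assms(1,3) by (simp add: \<rho>_def field_simps power2_eq_square)
  finally show "\<rho> / (\<rho>\<^sup>2 - (t * d)\<^sup>2) = b" by (simp add: diff)
  show "b < 1 / r"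
    unfolding \<open>b = (d + g) / (2 * r * d)\<close> using gd assms(1,3) by (simp add: field_simps)
qed

section \<open>The bounds for the Kobayashi metric\<close>

theorem theorem1p4:
  fixes D :: "(complex ^ 'n) set" and p \<xi> :: "complex ^ 'n"
  assumes "bounded D" and "convex D" and "open D" and "p \<in> D" and "\<xi> \<noteq> 0"
  shows
    "bullet_set D p \<xi> \<noteq> {} \<and> compact (bullet_set D p \<xi>) \<and> convex (bullet_set D p \<xi>) \<and>
     bullet_set D p \<xi> \<subseteq> D \<inter> {p + c *s \<xi> | c. True} \<and>
     (\<exists>!q. q \<in> bullet_set D p \<xi> \<and> norm (q - p) = infdist p (bullet_set D p \<xi>)) \<and>
     (\<forall>q. q \<in> bullet_set D p \<xi> \<and> norm (q - p) = infdist p (bullet_set D p \<xi>) \<longrightarrow>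
       (let r = centred_radius D p \<xi>;
            R = bullet_radius D p \<xi>;
            \<beta> = R - r;
            \<gamma> = (norm (q - p))\<^sup>2 - \<beta>\<^sup>2;
            bound2 = R / (R\<^sup>2 - (norm (q - p))\<^sup>2) * norm \<xi>;
            bound3 = 1 / (2 * r) * (\<beta>\<^sup>2 / (norm (q - p) * (norm (q - p) - sqrt \<gamma>))) * norm \<xi>
        in ((2 * r + \<beta>) * \<gamma> \<le> \<beta> * r\<^sup>2 \<longrightarrow>
              kobayashi_metric D p \<xi> \<le> bound2 \<and> (q \<noteq> p \<longrightarrow> bound2 < norm \<xi> / r)) \<and>
           ((2 * r + \<beta>) * \<gamma> > \<beta> * r\<^sup>2 \<longrightarrow>
              kobayashi_metric D p \<xi> \<le> bound3 \<and> (q \<noteq> p \<longrightarrow> bound3 < norm \<xi> / r))))"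
proof -
  define \<Omega> where "\<Omega> = slice D p \<xi>"
  define T where "T = tangent_point p \<xi>"
  define r where "r = centred_radius D p \<xi>"
  define R where "R = bullet_radius D p \<xi>"
  define C where "C = cball 0 R \<inter> {z. ball z R \<subseteq> \<Omega>}"
  define S where "S = bullet_set D p \<xi>"
  have \<Omega>: "bounded \<Omega>" "convex \<Omega>" "open \<Omega>" "0 \<in> \<Omega>"
    unfolding \<Omega>_def using assms bounded_slice convex_slice open_slice by (auto simp: slice_def)
  note centred = centred_ball_radius_Sup[OF \<Omega>(1,3,4),
      folded centred_radius_slice[of D p \<xi>, folded \<Omega>_def], folded r_def]
  note through = ball_through_radius_Sup[OF \<Omega>(1,3,4),
      folded bullet_radius_def[of D p \<xi>, folded \<Omega>_def], folded R_def]
  have "r \<le> R"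
    using through(1)[of 0 r] centred(1,2) by simp
  with centred(1) have "R > 0" by simp
  have S: "S = T ` C"
    unfolding S_def T_def C_def \<Omega>_def R_def
    using \<open>R > 0\<close> by (intro bullet_set_image) (simp add: R_def)
  have C_in: "z \<in> \<Omega>" if "z \<in> C" for z
    using that \<open>R > 0\<close> by (auto simp: C_def)
  have "C \<noteq> {}"
    using through(2) by (auto simp: C_def)
  then have S_ne: "S \<noteq> {}" by (simp add: S)
  have "compact C"
    unfolding C_def by (intro compact_Int_closed closed_ball_subset_centres) simp
  then have S_compact: "compact S"
    unfolding S T_def using assms(5)
    by (intro compact_continuous_image continuous_on_tangent_point)
  have "convex C"
    unfolding C_def using \<Omega>(2) \<open>R > 0\<close>
    by (intro convex_Int convex_cball convex_ball_subset_centres)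
  then have S_convex: "convex S"
    unfolding S T_def convex_alt
    by (auto simp flip: tangent_point_convex_combination)
  have S_sub: "S \<subseteq> D \<inter> {p + c *s \<xi> | c. True}"
    using C_in unfolding S T_def by (auto simp: \<Omega>_def slice_def tangent_point_def)
  have nearest: "\<exists>!q. q \<in> S \<and> norm (q - p) = infdist p S"
    using S_convex S_compact S_ne by (intro unique_nearest_point compact_imp_closed)
  have bounds: "let \<beta> = R - r;
            \<gamma> = (norm (q - p))\<^sup>2 - \<beta>\<^sup>2;
            bound2 = R / (R\<^sup>2 - (norm (q - p))\<^sup>2) * norm \<xi>;
            bound3 = 1 / (2 * r) * (\<beta>\<^sup>2 / (norm (q - p) * (norm (q - p) - sqrt \<gamma>))) * norm \<xi>
        in ((2 * r + \<beta>) * \<gamma> \<le> \<beta> * r\<^sup>2 \<longrightarrow>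
              kobayashi_metric D p \<xi> \<le> bound2 \<and> (q \<noteq> p \<longrightarrow> bound2 < norm \<xi> / r)) \<and>
           ((2 * r + \<beta>) * \<gamma> > \<beta> * r\<^sup>2 \<longrightarrow>
              kobayashi_metric D p \<xi> \<le> bound3 \<and> (q \<noteq> p \<longrightarrow> bound3 < norm \<xi> / r))"
    if q: "q \<in> S" "norm (q - p) = infdist p S" for q
  proof -
    obtain z where z: "z \<in> C" "q = T z" using q(1) S by blast
    define d \<beta> where "d = norm (q - p)" and "\<beta> = R - r"
    have d: "d = norm z"
      using dist_tangent_point[OF assms(5), of p z 0] by (simp add: d_def z(2) T_def dist_norm)
    have R: "R = r + \<beta>" by (simp add: \<beta>_def)
    have zball: "ball z R \<subseteq> \<Omega>" using z(1) by (simp add: C_def)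
    have "\<beta> \<ge> 0" using \<open>r \<le> R\<close> by (simp add: \<beta>_def)
    have "d \<ge> 0" by (simp add: d_def)
    \<comment> \<open>If both radii agree, \<open>0\<close> is an admissible centre, so \<open>p\<close> is its own nearest point.\<close>
    have d0: "d = 0" if "\<beta> = 0"
    proof -
      have "0 \<in> C" using that centred(1,2) R by (simp add: C_def)
      then have "T 0 \<in> S" unfolding S by (rule imageI)
      then have "p \<in> S" by (simp add: T_def)
      then show ?thesis using q(2) by (simp add: d_def)
    qed
    have qp: "q = p" if "d = 0" using that by (simp add: d_def)
    have case2: "kobayashi_metric D p \<xi> \<le> R / (R\<^sup>2 - d\<^sup>2) * norm \<xi> \<and>
        (q \<noteq> p \<longrightarrow> R / (R\<^sup>2 - d\<^sup>2) * norm \<xi> < norm \<xi> / r)"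
      if "(2 * r + \<beta>) * (d\<^sup>2 - \<beta>\<^sup>2) \<le> \<beta> * r\<^sup>2"
    proof (cases "\<beta> = 0")
      case True
      then have "norm z < R" using d0 d \<open>R > 0\<close> by simp
      then have "kobayashi_metric D p \<xi> \<le> R / (R\<^sup>2 - (norm z)\<^sup>2) * norm \<xi>"
        using assms(5) zball by (intro kobayashi_metric_le_disc) (simp_all add: \<Omega>_def)
      then show ?thesis using d0[OF True] qp d by simp
    next
      case False
      then have "\<beta> > 0" using \<open>\<beta> \<ge> 0\<close> by simp
      note less = disc_bound_less[OF centred(1) this that, folded R]
      have "norm z < R"
        using less(1) unfolding d by (rule power2_less_imp_less) (use \<open>R > 0\<close> in simp)
      then have "kobayashi_metric D p \<xi> \<le> R / (R\<^sup>2 - (norm z)\<^sup>2) * norm \<xi>"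
        using assms(5) zball by (intro kobayashi_metric_le_disc) (simp_all add: \<Omega>_def)
      moreover have "R / (R\<^sup>2 - d\<^sup>2) * norm \<xi> < 1 / r * norm \<xi>"
        using less(2) assms(5) by (intro mult_strict_right_mono) simp_all
      ultimately show ?thesis by (simp add: d)
    qed
    have case3: "kobayashi_metric D p \<xi> \<le>
          1 / (2 * r) * (\<beta>\<^sup>2 / (d * (d - sqrt (d\<^sup>2 - \<beta>\<^sup>2)))) * norm \<xi> \<and>
        1 / (2 * r) * (\<beta>\<^sup>2 / (d * (d - sqrt (d\<^sup>2 - \<beta>\<^sup>2)))) * norm \<xi> < norm \<xi> / r"
      if "\<beta> * r\<^sup>2 < (2 * r + \<beta>) * (d\<^sup>2 - \<beta>\<^sup>2)"
    proof -
      have "\<beta> \<noteq> 0" using that d0 by auto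
      with \<open>\<beta> \<ge> 0\<close> have "\<beta> > 0" by simp
      have "d \<noteq> 0"
      proof
        assume "d = 0"
        then have "(2 * r + \<beta>) * (d\<^sup>2 - \<beta>\<^sup>2) \<le> 0"
          using \<open>\<beta> > 0\<close> centred(1) by (simp add: mult_nonneg_nonpos)
        moreover have "\<beta> * r\<^sup>2 \<ge> 0" using \<open>\<beta> > 0\<close> by simp
        ultimately show False using that by linarith
      qed
      with \<open>d \<ge> 0\<close> have "d > 0" by simp
      define \<rho> where "\<rho> = r * d / sqrt (d\<^sup>2 - \<beta>\<^sup>2)"
      define t where "t = (\<rho> - r) / \<beta>"
      note hull = hull_disc_bound[OF centred(1) \<open>\<beta> > 0\<close> \<open>d > 0\<close> that, folded \<rho>_def, folded t_def]
      have "ball ((1 - t) *\<^sub>R 0 + t *\<^sub>R z) ((1 - t) * r + t * R) \<subseteq> \<Omega>"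
        using \<Omega>(2) centred(1,2) zball \<open>R > 0\<close> hull(1,2)
        by (intro ball_convex_combination_subset)
      moreover have "(1 - t) * r + t * R = \<rho>"
      proof -
        have "(1 - t) * r + t * R = r + t * \<beta>" by (simp add: R algebra_simps)
        then show ?thesis using \<open>\<beta> > 0\<close> by (simp add: t_def)
      qed
      ultimately have "ball (t *\<^sub>R z) \<rho> \<subseteq> slice D p \<xi>"
        by (simp add: \<Omega>_def)
      moreover have "norm (t *\<^sub>R z) = t * d"
        using hull(1) by (simp add: d)
      ultimately have "kobayashi_metric D p \<xi> \<le> \<rho> / (\<rho>\<^sup>2 - (t * d)\<^sup>2) * norm \<xi>"
        using kobayashi_metric_le_disc[OF assms(5), of "t *\<^sub>R z" \<rho>] hull(3) by simp
      moreover have "1 / (2 * r) * (\<beta>\<^sup>2 / (d * (d - sqrt (d\<^sup>2 - \<beta>\<^sup>2)))) * norm \<xi> < 1 / r * norm \<xi>"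
        using hull(5) assms(5) by (intro mult_strict_right_mono) simp_all
      ultimately show ?thesis unfolding hull(4) by simp
    qed
    show ?thesis
      unfolding Let_def d_def[symmetric] \<beta>_def[symmetric]
      using case2 case3 by blast
  qed
  show ?thesis
    unfolding S_def[symmetric] r_def[symmetric] R_def[symmetric] Let_def
    by (intro conjI[OF S_ne conjI[OF S_compact conjI[OF S_convex conjI[OF S_sub conjI[OF nearest]]]]]
        allI impI bounds[unfolded Let_def]) simp_all
qed

end
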